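(* Let $p$ be a prime with $p \equiv 1 \pmod{3}$, and let $R = \Gamma_{\mathbb F_p}(p_1l_1,\; p_1p_2l_1(p_1+p_2+p_1p_2))$. Then $|\mathrm{Aut}(R)| = p$, and $R$ cannot be presented in the form $\Gamma_{\mathbb F_p}(p_1l_1, h(p_1,l_1))$, i.e., there is no function $h:\mathbb F_p^2\to\mathbb F_p$ such that $R$ is isomorphic to $\Gamma_{\mathbb F_p}(p_1l_1, h(p_1,l_1))$.
   Context: For a finite field $\mathbb F$ and functions $f:\mathbb F^2\to\mathbb F$, $g:\mathbb F^3\to\mathbb F$, the graph $\Gamma_{\mathbb F}(f(p_1,l_1), g(p_1,p_2,l_1))$ is the bipartite graph whose two parts are the set $P$ of points $(p_1,p_2,p_3)\in\mathbb F^3$ and the set $L$ of lines $[l_1,l_2,l_3]\in\mathbb F^3$ (two disjoint copies of $\mathbb F^3$), where a point $(p_1,p_2,p_3)$ is adjacent to a line $[l_1,l_2,l_3]$ if and only if $p_2+l_2 = f(p_1,l_1)$ and $p_3+l_3 = g(p_1,p_2,l_1)$. The graph $\Gamma_{\mathbb F}(f(p_1,l_1), h(p_1,l_1))$ is defined in the same way with $h:\mathbb F^2\to\mathbb F$ in place of $g$. $\mathrm{Aut}(\cdot)$ denotes the automorphism group of a graph. *)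

theory Defs
  imports
    "Graph_Theory.Graph_Theory"
    "HOL-Algebra.Bij"
    "HOL-Algebra.Coset"
    "HOL-Library.Cardinality"
    "HOL-Number_Theory.Cong"
    "HOL-Computational_Algebra.Primes"
begin

text \<open>
  Undirected simple graphs are represented as \<open>pair_graph\<close>s: loop-free digraphs whose arc set is
  symmetric. Points are the left and lines the right summand of the vertex type.
\<close>

definition point_line_incidence ::
  "('a::{field,finite} \<Rightarrow> 'a \<Rightarrow> 'a) \<Rightarrow> ('a \<Rightarrow> 'a \<Rightarrow> 'a \<Rightarrow> 'a)
    \<Rightarrow> ('a \<times> 'a \<times> 'a + 'a \<times> 'a \<times> 'a) rel" where
  "point_line_incidence f g =
    {(Inl (p1, p2, p3), Inr (l1, l2, l3)) | p1 p2 p3 l1 l2 l3.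
      p2 + l2 = f p1 l1 \<and> p3 + l3 = g p1 p2 l1}"

definition Gamma ::
  "('a::{field,finite} \<Rightarrow> 'a \<Rightarrow> 'a) \<Rightarrow> ('a \<Rightarrow> 'a \<Rightarrow> 'a \<Rightarrow> 'a)
    \<Rightarrow> ('a \<times> 'a \<times> 'a + 'a \<times> 'a \<times> 'a) pair_pre_digraph" where
  "Gamma f g =
    \<lparr>pverts = UNIV, parcs = point_line_incidence f g \<union> (point_line_incidence f g)\<inverse>\<rparr>"

lemma pair_graph_Gamma: "pair_graph (Gamma f g)"
  by unfold_locales
    (auto simp: Gamma_def point_line_incidence_def symmetric_def sym_def)

lemma digraph_iso_with_proj_iff:
  assumes "pair_wf_digraph G" and "pair_wf_digraph H"
  shows "digraph_iso (with_proj G) (with_proj H) \<longleftrightarrow>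
    (\<exists>\<phi>. bij_betw \<phi> (pverts G) (pverts H) \<and>
      (\<forall>u\<in>pverts G. \<forall>v\<in>pverts G. (\<phi> u, \<phi> v) \<in> parcs H \<longleftrightarrow> (u, v) \<in> parcs G))"
    (is "?L \<longleftrightarrow> ?R")
proof
  assume ?L
  then obtain f where f: "pre_digraph.digraph_isomorphism (with_proj G) f"
    and H: "with_proj H = app_iso f (with_proj G)"
    by (auto simp: digraph_iso_def)
  let ?\<phi> = "iso_verts f"
  have V: "pverts H = ?\<phi> ` pverts G" and A: "parcs H = iso_arcs f ` parcs G"
    and T: "iso_tail f = fst" and Hd: "iso_head f = snd"
    using H by (auto simp: with_proj_def app_iso_def)
  have inj: "inj_on ?\<phi> (pverts G)"
    and arc: "\<And>a. a \<in> parcs G \<Longrightarrow> iso_arcs f a = (?\<phi> (fst a), ?\<phi> (snd a))"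
    using f T Hd by (auto simp: pre_digraph.digraph_isomorphism_def prod_eq_iff)
  have "(?\<phi> u, ?\<phi> v) \<in> parcs H \<longleftrightarrow> (u, v) \<in> parcs G"
    if uv: "u \<in> pverts G" "v \<in> pverts G" for u v
  proof
    assume "(?\<phi> u, ?\<phi> v) \<in> parcs H"
    then obtain a where a: "a \<in> parcs G" "?\<phi> (fst a) = ?\<phi> u" "?\<phi> (snd a) = ?\<phi> v"
      using A arc by auto
    then have "fst a = u" "snd a = v"
      using inj uv pair_wf_digraph.arc_fst_in_verts[OF assms(1) a(1)]
        pair_wf_digraph.arc_snd_in_verts[OF assms(1) a(1)]
      by (auto dest: inj_onD)
    then show "(u, v) \<in> parcs G" using a(1) by auto
  next
    assume "(u, v) \<in> parcs G"
    then show "(?\<phi> u, ?\<phi> v) \<in> parcs H" using A arc by force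
  qed
  then show ?R using inj V by (intro exI[of _ ?\<phi>]) (auto simp: bij_betw_def)
next
  assume ?R
  then obtain \<phi> where b: "bij_betw \<phi> (pverts G) (pverts H)"
    and adj: "\<And>u v. u \<in> pverts G \<Longrightarrow> v \<in> pverts G \<Longrightarrow>
      (\<phi> u, \<phi> v) \<in> parcs H \<longleftrightarrow> (u, v) \<in> parcs G"
    by blast
  have G: "(u, v) \<in> parcs G \<Longrightarrow> u \<in> pverts G \<and> v \<in> pverts G" for u v
    using pair_wf_digraph.in_arcsD1[OF assms(1)] pair_wf_digraph.in_arcsD2[OF assms(1)] by blast
  have H: "(u, v) \<in> parcs H \<Longrightarrow> u \<in> pverts H \<and> v \<in> pverts H" for u v
    using pair_wf_digraph.in_arcsD1[OF assms(2)] pair_wf_digraph.in_arcsD2[OF assms(2)] by blast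
  have inj: "inj_on \<phi> (pverts G)" and V: "\<phi> ` pverts G = pverts H"
    using b by (auto simp: bij_betw_def)
  have A: "map_prod \<phi> \<phi> ` parcs G = parcs H"
  proof (intro subset_antisym subsetI)
    fix a assume "a \<in> map_prod \<phi> \<phi> ` parcs G"
    then show "a \<in> parcs H" using adj G by auto
  next
    fix a assume a: "a \<in> parcs H"
    then have "fst a \<in> \<phi> ` pverts G" "snd a \<in> \<phi> ` pverts G"
      using H[of "fst a" "snd a"] V by auto
    then obtain u v where "u \<in> pverts G" "v \<in> pverts G" "a = (\<phi> u, \<phi> v)"
      by (auto simp: prod_eq_iff)
    then show "a \<in> map_prod \<phi> \<phi> ` parcs G" using a adj by force
  qed
  have "inj_on (map_prod \<phi> \<phi>) (parcs G)"
    using inj G by (auto simp: inj_on_def)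
  then have "pre_digraph.digraph_isomorphism (with_proj G)
      \<lparr>iso_verts = \<phi>, iso_arcs = map_prod \<phi> \<phi>, iso_head = snd, iso_tail = fst\<rparr>"
    using inj assms(1) by (simp add: pre_digraph.digraph_isomorphism_def wf_digraph_wp_iff)
  moreover have "with_proj H = app_iso
      \<lparr>iso_verts = \<phi>, iso_arcs = map_prod \<phi> \<phi>, iso_head = snd, iso_tail = fst\<rparr> (with_proj G)"
    using A V by (simp add: app_iso_def with_proj_def)
  ultimately show ?L unfolding digraph_iso_def by blast
qed

text \<open>
  As in \<open>Bij\<close>, automorphisms are made extensional outside the vertex set, so that each one is
  counted once.
\<close>

definition graph_automorphisms :: "'v pair_pre_digraph \<Rightarrow> ('v \<Rightarrow> 'v) set" where
  "graph_automorphisms G =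
    {\<phi> \<in> Bij (pverts G).
      \<forall>u\<in>pverts G. \<forall>v\<in>pverts G. (\<phi> u, \<phi> v) \<in> parcs G \<longleftrightarrow> (u, v) \<in> parcs G}"

definition Aut :: "'v pair_pre_digraph \<Rightarrow> ('v \<Rightarrow> 'v) monoid" where
  "Aut G = BijGroup (pverts G) \<lparr>carrier := graph_automorphisms G\<rparr>"

lemma subgroup_graph_automorphisms:
  "subgroup (graph_automorphisms G) (BijGroup (pverts G))"
proof -
  interpret B: group "BijGroup (pverts G)" by (rule group_BijGroup)
  show ?thesis
  proof (rule B.subgroupI)
    show "graph_automorphisms G \<subseteq> carrier (BijGroup (pverts G))"
      by (auto simp: graph_automorphisms_def BijGroup_def)
    have "(\<lambda>x\<in>pverts G. x) \<in> graph_automorphisms G"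
      by (auto simp: graph_automorphisms_def id_Bij)
    then show "graph_automorphisms G \<noteq> {}" by blast
  next
    fix \<phi> assume \<phi>: "\<phi> \<in> graph_automorphisms G"
    then have B: "\<phi> \<in> Bij (pverts G)" by (simp add: graph_automorphisms_def)
    define \<psi> where "\<psi> = (\<lambda>x\<in>pverts G. inv_into (pverts G) \<phi> x)"
    have in_V: "\<psi> x \<in> pverts G" and right_inv: "\<phi> (\<psi> x) = x" if "x \<in> pverts G" for x
      using B that by (auto simp: \<psi>_def Bij_def bij_betw_def inv_into_into f_inv_into_f)
    have "(\<psi> u, \<psi> v) \<in> parcs G \<longleftrightarrow> (u, v) \<in> parcs G"
      if "u \<in> pverts G" "v \<in> pverts G" for u v
    proof -
      have "(\<phi> (\<psi> u), \<phi> (\<psi> v)) \<in> parcs G \<longleftrightarrow> (\<psi> u, \<psi> v) \<in> parcs G"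
        using \<phi> in_V[OF that(1)] in_V[OF that(2)] unfolding graph_automorphisms_def by blast
      then show ?thesis using right_inv that by simp
    qed
    moreover have "\<psi> \<in> Bij (pverts G)"
      unfolding \<psi>_def by (rule restrict_inv_into_Bij[OF B])
    ultimately have "\<psi> \<in> graph_automorphisms G" by (simp add: graph_automorphisms_def)
    then show "inv\<^bsub>BijGroup (pverts G)\<^esub> \<phi> \<in> graph_automorphisms G"
      by (simp add: inv_BijGroup[OF B] \<psi>_def)
  next
    fix \<phi> \<psi> assume aut: "\<phi> \<in> graph_automorphisms G" "\<psi> \<in> graph_automorphisms G"
    then have "\<psi> u \<in> pverts G" if "u \<in> pverts G" for u
      using that by (auto simp: graph_automorphisms_def dest: Bij_imp_funcset[THEN funcset_mem])
    with aut show "\<phi> \<otimes>\<^bsub>BijGroup (pverts G)\<^esub> \<psi> \<in> graph_automorphisms G"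
      by (simp add: graph_automorphisms_def BijGroup_def compose_Bij compose_eq)
  qed
qed

lemma group_Aut: "group (Aut G)"
  unfolding Aut_def
  by (rule subgroup.subgroup_is_group[OF subgroup_graph_automorphisms group_BijGroup])

end

theory Submission
  imports
    Defs
    "HOL-Computational_Algebra.Polynomial"
    "HOL-Number_Theory.Residues"
begin

text \<open>
  Write \<open>G = p1 p2 (p1 + p2 + p1 p2)\<close>. The paths of length three from a point to a nonadjacent line
  correspond to roots of a polynomial of degree at most four, so there are at most four of them
  unless \<open>G\<close> is affine linear along the line. These exceptional (rich) pairs only involve the lines
  \<open>[0, 0, z]\<close> and \<open>[0, 1, z]\<close>. Counting them shows that an automorphism preserves both families of
  lines and the set of points \<open>(0, b, c)\<close>, and acts on those points as a translation of the third
  coordinate.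

  If an automorphism fixes all points \<open>(0, b, c)\<close>, it maps \<open>[x, y, z]\<close> to some \<open>[x', y, z]\<close> and
  preserves \<open>G / p1\<close>. Along \<open>[x, y, z]\<close> this is a polynomial in \<open>p1\<close> of degree at most three with
  leading term \<open>x\<^sup>2 p1\<^sup>3\<close>, and its power sum of exponent \<open>(p - 1) / 3\<close> vanishes iff \<open>x = 0\<close>. So the
  lines \<open>[0, y, z]\<close> are fixed, and then everything is.

  A graph with \<open>h(p1, l1)\<close> in the second equation has the \<open>p\<^sup>2\<close> translations of the last two
  coordinates as automorphisms, too many to be isomorphic to \<open>R\<close>.
\<close>

section \<open>Finite fields\<close>

lemma CHAR_eq_CARD:
  assumes "prime CARD('a::{field,finite})"
  shows "CHAR('a) = CARD('a)"
proof -
  have "CHAR('a) dvd CARD('a)" by (rule CHAR_dvd_CARD)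
  moreover have "CHAR('a) \<noteq> 1"
    by simp
  ultimately show ?thesis using assms prime_nat_iff by blast
qed

text \<open>The characteristic is \<open>CARD('a)\<close>, so the first \<open>CARD('a)\<close>
  naturals have distinct images and exhaust the field. This lets induction along
  \<open>c \<mapsto> c + 1\<close> reach every element.\<close>

lemma prime_field_of_nat:
  assumes "prime CARD('a::{field,finite})"
  obtains n where "x = (of_nat n :: 'a)"
proof -
  have "inj_on (of_nat :: nat \<Rightarrow> 'a) {..<CARD('a)}"
    using CHAR_eq_CARD[OF assms] by (auto simp: inj_on_def of_nat_eq_iff_cong_CHAR cong_def)
  then have "card ((of_nat :: nat \<Rightarrow> 'a) ` {..<CARD('a)}) = CARD('a)"
    by (simp add: card_image)
  then have "(of_nat :: nat \<Rightarrow> 'a) ` {..<CARD('a)} = UNIV"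
    by (intro card_subset_eq) auto
  then show thesis using that by blast
qed

lemma of_nat_CARD_eq_0: "of_nat CARD('a::{field,finite}) = (0::'a)"
  by (simp add: of_nat_eq_0_iff_char_dvd CHAR_dvd_CARD)

text \<open>Multiplying the summation variable by \<open>g\<close> scales the sum by
  \<open>g ^ k\<close>, so it vanishes once \<open>g ^ k \<noteq> 1\<close>. Such a nonzero
  \<open>g\<close> exists because \<open>X ^ k - 1\<close> has at most \<open>k\<close> roots. For
  \<open>k = 0\<close> the convention \<open>0 ^ 0 = 1\<close> makes the sum
  \<open>of_nat CARD('a)\<close>, which is zero.\<close>

lemma sum_power_eq_0:
  assumes "k < CARD('a::{field,finite}) - 1"
  shows "(\<Sum>a\<in>(UNIV::'a set). a ^ k) = 0"
proof (cases "k = 0")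
  case True
  then show ?thesis using of_nat_CARD_eq_0[where 'a='a] by simp
next
  case False
  have "\<exists>g::'a. g \<noteq> 0 \<and> g ^ k \<noteq> 1"
  proof (rule ccontr)
    assume "\<nexists>g::'a. g \<noteq> 0 \<and> g ^ k \<noteq> 1"
    then have roots: "UNIV - {0} \<subseteq> {x::'a. poly (Polynomial.monom 1 k - 1) x = 0}"
      by (auto simp: poly_monom)
    have deg: "Polynomial.degree (Polynomial.monom 1 k - 1 :: 'a poly) \<le> k"
      by (rule degree_diff_le) (auto simp: degree_monom_le)
    have "poly (Polynomial.monom 1 k - 1 :: 'a poly) 0 \<noteq> 0"
      using False by (simp add: poly_monom power_0_left)
    then have nz: "Polynomial.monom 1 k - 1 \<noteq> (0 :: 'a poly)" by (metis poly_0)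
    have "CARD('a) - 1 = card (UNIV - {0::'a})" by (simp add: card_Diff_subset)
    also have "\<dots> \<le> card {x::'a. poly (Polynomial.monom 1 k - 1) x = 0}"
      by (rule card_mono[OF _ roots]) simp
    also have "\<dots> \<le> k"
      using card_poly_roots_bound[OF nz] deg by linarith
    finally show False using assms by simp
  qed
  then obtain g :: 'a where g: "g \<noteq> 0" "g ^ k \<noteq> 1" by blast
  have "bij ((*) g)"
    by (rule bij_betw_byWitness[where f' = "\<lambda>x. x / g"]) (use g in auto)
  then have "(\<Sum>a\<in>UNIV. a ^ k) = (\<Sum>a\<in>UNIV. (g * a) ^ k)"
    by (rule sum.reindex_bij_betw[symmetric])
  also have "\<dots> = g ^ k * (\<Sum>a\<in>UNIV. a ^ k)"
    by (simp add: power_mult_distrib sum_distrib_left)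
  finally have "(1 - g ^ k) * (\<Sum>a\<in>UNIV. a ^ k) = 0" by (simp add: algebra_simps)
  then show ?thesis using g by simp
qed

text \<open>Every nonzero \<open>a\<close> contributes 1 by Fermat, which follows from the product
  of all nonzero elements being invariant under multiplication by \<open>a\<close>.\<close>

lemma sum_power_CARD_minus_1:
  "(\<Sum>a\<in>(UNIV::'a::{field,finite} set). a ^ (CARD('a) - 1)) = -1"
proof -
  have one: "a ^ (CARD('a) - 1) = 1" if "a \<noteq> 0" for a :: 'a
  proof -
    have "\<Prod>(UNIV - {0::'a}) = (\<Prod>y\<in>UNIV - {0}. a * y)"
      by (rule prod.reindex_bij_witness[of _ "\<lambda>y. a * y" "\<lambda>y. y / a"]) (use that in auto)
    also have "\<dots> = a ^ (CARD('a) - 1) * \<Prod>(UNIV - {0::'a})"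
      by (simp add: prod.distrib card_Diff_subset)
    finally show ?thesis by simp
  qed
  have "card {0, 1::'a} \<le> CARD('a)" by (rule card_mono) auto
  then have "CARD('a) - 1 \<noteq> 0" by simp
  then have "(\<Sum>a\<in>(UNIV::'a set). a ^ (CARD('a) - 1)) = (\<Sum>a\<in>UNIV - {0::'a}. 1)"
    using one by (intro sum.mono_neutral_cong_right) (auto simp: power_0_left)
  also have "\<dots> = of_nat (CARD('a) - 1)" by (simp add: card_Diff_subset)
  also have "\<dots> = -1" using of_nat_CARD_eq_0[where 'a='a]
    by (simp add: of_nat_diff)
  finally show ?thesis .
qed

text \<open>Within this degree bound only the monomial of degree \<open>CARD('a) - 1\<close> has a
  nonzero power sum.\<close>

lemma sum_poly_UNIV:
  fixes q :: "'a::{field,finite} poly"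
  assumes "Polynomial.degree q \<le> CARD('a) - 1"
  shows "(\<Sum>a\<in>UNIV. poly q a) = - Polynomial.coeff q (CARD('a) - 1)"
proof -
  let ?n = "CARD('a) - 1"
  have "(\<Sum>a\<in>UNIV. poly q a) = (\<Sum>a\<in>UNIV. \<Sum>i\<le>?n. Polynomial.coeff q i * a ^ i)"
  proof (rule sum.cong[OF refl])
    fix a :: 'a
    show "poly q a = (\<Sum>i\<le>?n. Polynomial.coeff q i * a ^ i)"
      unfolding poly_altdef using assms
      by (intro sum.mono_neutral_left) (auto simp: coeff_eq_0)
  qed
  also have "\<dots> = (\<Sum>i\<le>?n. Polynomial.coeff q i * (\<Sum>a\<in>UNIV. a ^ i))"
    by (subst sum.swap) (simp add: sum_distrib_left)
  also have "\<dots> = (\<Sum>i\<le>?n. if i = ?n then - Polynomial.coeff q i else 0)"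
    by (rule sum.cong) (auto simp: sum_power_eq_0 sum_power_CARD_minus_1[unfolded One_nat_def])
  also have "\<dots> = - Polynomial.coeff q ?n" by simp
  finally show ?thesis .
qed


section \<open>The graph and its rich pairs\<close>

text \<open>The quotient \<open>G / p1\<close>, extended to \<open>p1 = 0\<close> as a polynomial.\<close>

definition \<mu> :: "'a::field \<Rightarrow> 'a \<Rightarrow> 'a" where
  "\<mu> a b = b * (a + b + a * b)"

abbreviation graph_R :: "('a::{field,finite} \<times> 'a \<times> 'a + 'a \<times> 'a \<times> 'a) pair_pre_digraph" where
  "graph_R \<equiv> Gamma (\<lambda>p1 l1. p1 * l1) (\<lambda>p1 p2 l1. p1 * p2 * l1 * (p1 + p2 + p1 * p2))"

type_synonym 'a vertex = "'a \<times> 'a \<times> 'a + 'a \<times> 'a \<times> 'a"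

definition adj :: "'a::{field,finite} vertex \<Rightarrow> 'a vertex \<Rightarrow> bool" where
  "adj u v \<longleftrightarrow> (u, v) \<in> parcs graph_R"

lemma adj_simps [simp]:
  "adj (Inl (a, b, c)) (Inr (x, y, z)) \<longleftrightarrow> b + y = a * x \<and> c + z = a * x * \<mu> a b"
  "adj (Inr (x, y, z)) (Inl (a, b, c)) \<longleftrightarrow> b + y = a * x \<and> c + z = a * x * \<mu> a b"
  "\<not> adj (Inl u) (Inl v)" "\<not> adj (Inr u') (Inr v')"
  by (auto simp: adj_def Gamma_def point_line_incidence_def \<mu>_def mult.assoc mult.commute mult.left_commute)

lemma adj_sym: "adj u v \<longleftrightarrow> adj v u"
  by (auto simp: adj_def Gamma_def)

text \<open>Only the two inner vertices are recorded. If \<open>u\<close> and \<open>v\<close> are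
  not adjacent, such a walk is automatically a path, since \<open>w = u\<close> or
  \<open>n = v\<close> would give an edge between them.\<close>

definition paths3 :: "'a::{field,finite} vertex \<Rightarrow> 'a vertex \<Rightarrow> ('a vertex \<times> 'a vertex) set" where
  "paths3 u v = {(n, w). adj u n \<and> adj n w \<and> adj w v}"

text \<open>The threshold 5 exceeds the number of roots of a nonzero polynomial of degree at most
  4.\<close>

definition rich :: "'a::{field,finite} vertex \<Rightarrow> 'a vertex \<Rightarrow> bool" where
  "rich u v \<longleftrightarrow> \<not> adj u v \<and> 5 \<le> card (paths3 u v)"

lemma rich_sym: "rich u v \<longleftrightarrow> rich v u"
proof -
  have "paths3 v u = prod.swap ` paths3 u v"
    by (auto simp: paths3_def image_iff adj_sym)
  then have "card (paths3 v u) = card (paths3 u v)"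
    by (simp add: card_image)
  then show ?thesis by (simp add: rich_def adj_sym)
qed

lemma adj_imp_opposite_sides: "adj u v \<Longrightarrow> isl u \<longleftrightarrow> \<not> isl v"
  by (cases u; cases v) auto

lemma not_rich_same_side [simp]:
  fixes P Q L M :: "'a::{field,finite} \<times> 'a \<times> 'a"
  shows "\<not> rich (Inl P) (Inl Q)" "\<not> rich (Inr L) (Inr M)"
proof -
  have "paths3 u v = {}" if "isl u \<longleftrightarrow> isl v" for u v :: "'a vertex"
    using that by (auto simp: paths3_def dest!: adj_imp_opposite_sides)
  then show "\<not> rich (Inl P) (Inl Q)" "\<not> rich (Inr L) (Inr M)"
    by (simp_all add: rich_def)
qed

text \<open>A walk is determined by the first coordinate \<open>a\<close> of its inner point, and
  \<open>a\<close> is a root of the polynomial \<open>F\<close> of degree at most 4. Five walks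
  force \<open>F = 0\<close>, and the coefficients of \<open>F\<close> give the conditions.\<close>

lemma rich_point_line_imp:
  assumes "rich (Inl (a0, b0, c0)) (Inr (x, y, z))"
  shows "x = 0 \<and> (y = 0 \<and> b0 \<noteq> 0 \<and> a0 * \<mu> a0 b0 = 0 \<and> z = - c0 \<or>
    y = 1 \<and> b0 \<noteq> -1 \<and> a0 * \<mu> a0 b0 = a0 \<and> z = 1 + b0 - c0)"
proof -
  \<comment> \<open>\<open>e\<close> and \<open>k\<close> measure how far the given point and line
    are from satisfying the two incidence equations.\<close>
  define e where "e = a0 * x - y - b0"
  define k where "k = a0 * x * \<mu> a0 b0 - z - c0"
  define F where "F = [: k * a0 - e * (a0 * \<mu> a0 b0), e * y\<^sup>2 - k, e * (y\<^sup>2 - y - 2 * x * y),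
    e * (x\<^sup>2 + x - 2 * x * y), e * x\<^sup>2 :]"
  have polyF: "poly F a = e * (a * \<mu> a (a * x - y) - a0 * \<mu> a0 b0) - k * (a - a0)" for a
    unfolding F_def \<mu>_def by (simp add: algebra_simps power2_eq_square)
  have nadj: "\<not> (e = 0 \<and> k = 0)"
    using assms by (auto simp: rich_def e_def k_def algebra_simps)
  \<comment> \<open>\<open>f\<close> rebuilds the walk from \<open>a\<close>. Division by zero makes
    its value at \<open>a0\<close> meaningless, but no walk has \<open>a = a0\<close>.\<close>
  define f where "f a = (let s = x + e / (a - a0) in
    (Inr (s, a0 * s - b0, a0 * s * \<mu> a0 b0 - c0) :: 'a vertex,
     Inl (a, a * x - y, a * x * \<mu> a (a * x - y) - z) :: 'a vertex))" for a
  have path: "e \<noteq> 0 \<and> (n, w) \<in> f ` {a. poly F a = 0}"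
    if nw: "(n, w) \<in> paths3 (Inl (a0, b0, c0)) (Inr (x, y, z))" for n w
  proof -
    obtain s t r where n: "n = Inr (s, t, r)"
      using nw by (cases n) (auto simp: paths3_def)
    obtain a b c where w: "w = Inl (a, b, c)"
      using nw n by (cases w) (auto simp: paths3_def)
    have t: "t = a0 * s - b0" and r: "r = a0 * s * \<mu> a0 b0 - c0"
      and b: "b = a * x - y" and c: "c = a * x * \<mu> a b - z"
      and bt: "b + t = a * s" and cr: "c + r = a * s * \<mu> a b"
      using nw by (auto simp: paths3_def n w algebra_simps)
    \<comment> \<open>Both defects contain the factor \<open>s - x\<close>; eliminating it yields
      \<open>poly F a = 0\<close>.\<close>
    have e: "e = (a - a0) * (s - x)"
      using bt unfolding t b e_def by (simp add: algebra_simps)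
    have k: "k = (s - x) * (a * \<mu> a b - a0 * \<mu> a0 b0)"
      using cr unfolding r c k_def by (simp add: algebra_simps)
    have "a \<noteq> a0"
    proof
      assume "a = a0"
      moreover from this have "b = b0" using bt t by (simp add: algebra_simps)
      ultimately show False using e k nadj by simp
    qed
    moreover have "s \<noteq> x" using e k nadj by auto
    ultimately have "e \<noteq> 0" using e by simp
    have s: "s = x + e / (a - a0)" using e \<open>a \<noteq> a0\<close> by (simp add: field_simps)
    have "poly F a = 0"
      unfolding polyF b[symmetric] e k by (simp add: algebra_simps)
    moreover have "(n, w) = f a"
      unfolding f_def Let_def s[symmetric] n w t r c b by simp
    ultimately show ?thesis using \<open>e \<noteq> 0\<close> by blast
  qed
  have card5: "5 \<le> card (paths3 (Inl (a0, b0, c0)) (Inr (x, y, z)))"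
    using assms by (simp add: rich_def)
  then have "paths3 (Inl (a0, b0, c0)) (Inr (x, y, z)) \<noteq> {}" by force
  then have e0: "e \<noteq> 0" using path by fast
  have "F = 0"
  proof (rule ccontr)
    assume "F \<noteq> 0"
    have "Polynomial.degree F \<le> 4" unfolding F_def by (simp add: degree_pCons_eq_if)
    then have "card {a. poly F a = 0} \<le> 4"
      using card_poly_roots_bound[OF \<open>F \<noteq> 0\<close>] by linarith
    moreover have "card (paths3 (Inl (a0, b0, c0)) (Inr (x, y, z))) \<le> card (f ` {a. poly F a = 0})"
      using path by (intro card_mono) auto
    moreover have "card (f ` {a. poly F a = 0}) \<le> card {a. poly F a = 0}"
      by (rule card_image_le) simp
    ultimately show False using card5 by linarith
  qed
  \<comment> \<open>Degree 4 gives \<open>x = 0\<close>, degree 2 then \<open>y\<^sup>2 = y\<close>,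
    degree 1 the value of \<open>k\<close>, and the constant term the last equation.\<close>
  then have x: "x = 0" and "e * (y\<^sup>2 - y) = 0" and k: "k = e * y\<^sup>2"
    and c: "k * a0 = e * (a0 * \<mu> a0 b0)"
    using e0 by (auto simp: F_def)
  then have "y * (y - 1) = 0" using e0 by (simp add: power2_eq_square algebra_simps)
  then consider "y = 0" | "y = 1" by auto
  then show ?thesis
  proof cases
    case 1
    then have "k = 0" using k by simp
    moreover from this have "a0 * \<mu> a0 b0 = 0" using c e0 by simp
    moreover have "b0 \<noteq> 0" using e0 1 x unfolding e_def by auto
    moreover have "z = - c0" using \<open>k = 0\<close> 1 x unfolding k_def by auto
    ultimately show ?thesis using 1 x by simp
  next
    case 2
    then have "k = e" using k by simp
    moreover from this have "a0 * \<mu> a0 b0 = a0" using c e0 by simp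
    moreover have "b0 \<noteq> -1" using e0 2 x unfolding e_def by auto
    moreover have "z = 1 + b0 - c0" using \<open>k = e\<close> 2 x unfolding e_def k_def
      by (simp add: algebra_simps)
    ultimately show ?thesis using 2 x by simp
  qed
qed

text \<open>The hypothesis \<open>paths\<close> says that the polynomial of
  \<open>rich_point_line_imp\<close> vanishes identically for \<open>x = 0\<close>. Each of the at
  least six values \<open>a \<noteq> a0\<close> then yields a walk, and
  \<open>y + b0 \<noteq> 0\<close> excludes adjacency.\<close>

lemma richI:
  fixes a0 b0 c0 y z :: "'a::{field,finite}"
  assumes "7 \<le> CARD('a)" and e0: "y + b0 \<noteq> 0"
    and paths: "\<And>a. (z + c0) * (a - a0) = (y + b0) * (a * \<mu> a (- y) - a0 * \<mu> a0 b0)"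
  shows "rich (Inl (a0, b0, c0)) (Inr (0, y, z))"
proof -
  define s where "s a = - (y + b0) / (a - a0)" for a
  define f where "f a =
    (Inr (s a, a0 * s a - b0, a0 * s a * \<mu> a0 b0 - c0) :: 'a vertex,
     Inl (a, - y, - z) :: 'a vertex)" for a
  have "f ` (UNIV - {a0}) \<subseteq> paths3 (Inl (a0, b0, c0)) (Inr (0, y, z))"
  proof
    fix q assume "q \<in> f ` (UNIV - {a0})"
    then obtain a where a: "a \<noteq> a0" and q: "q = f a" by auto
    have s: "(a - a0) * s a = - (y + b0)" using a by (simp add: s_def)
    have "(a - a0) * (s a * (a * \<mu> a (- y) - a0 * \<mu> a0 b0)) =
        - (y + b0) * (a * \<mu> a (- y) - a0 * \<mu> a0 b0)"
      by (simp only: mult.assoc[symmetric] s)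
    also have "\<dots> = (a - a0) * (- (z + c0))"
      using paths[of a] by (simp only: mult_minus_left mult_minus_right mult.commute)
    finally have "(a - a0) * (s a * (a * \<mu> a (- y) - a0 * \<mu> a0 b0)) = (a - a0) * (- (z + c0))" .
    then have "s a * (a * \<mu> a (- y) - a0 * \<mu> a0 b0) = - (z + c0)"
      using a by (subst (asm) mult_cancel_left) auto
    then show "q \<in> paths3 (Inl (a0, b0, c0)) (Inr (0, y, z))"
      using s unfolding q f_def paths3_def by (simp add: algebra_simps)
  qed
  moreover have "inj f" by (auto simp: inj_def f_def)
  then have "card (f ` (UNIV - {a0})) = CARD('a) - 1"
    by (subst card_image) (auto simp: inj_on_def inj_def card_Diff_subset)
  ultimately have "CARD('a) - 1 \<le> card (paths3 (Inl (a0, b0, c0)) (Inr (0, y, z)))"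
    by (metis card_mono finite)
  then show ?thesis using assms(1) e0 by (simp add: rich_def add.commute)
qed

lemma rich_point_line_iff:
  fixes a b c x y z :: "'a::{field,finite}"
  assumes "7 \<le> CARD('a)"
  shows "rich (Inl (a, b, c)) (Inr (x, y, z)) \<longleftrightarrow>
    x = 0 \<and> (y = 0 \<and> b \<noteq> 0 \<and> a * \<mu> a b = 0 \<and> z = - c \<or>
      y = 1 \<and> b \<noteq> -1 \<and> a * \<mu> a b = a \<and> z = 1 + b - c)"
    (is "_ = ?R")
proof
  assume ?R
  then consider "x = 0" "y = 0" "b \<noteq> 0" "a * \<mu> a b = 0" "z = - c"
    | "x = 0" "y = 1" "b \<noteq> -1" "a * \<mu> a b = a" "z = 1 + b - c" by blast
  then show "rich (Inl (a, b, c)) (Inr (x, y, z))"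
  proof cases
    case 1
    then have "rich (Inl (a, b, c)) (Inr (0, y, z))"
      by (intro richI assms) (auto simp: \<mu>_def)
    then show ?thesis using 1 by simp
  next
    case 2
    have "1 + b \<noteq> 0" using 2(3) by (metis add.commute add_eq_0_iff)
    then have "rich (Inl (a, b, c)) (Inr (0, y, z))"
      using 2 by (intro richI assms) (auto simp: \<mu>_def)
    then show ?thesis using 2 by simp
  qed
qed (rule rich_point_line_imp)

section \<open>Counting the rich pairs at each vertex\<close>

definition rich_degree :: "'a::{field,finite} vertex \<Rightarrow> nat" where
  "rich_degree u = card {v. rich u v}"

lemma rich_degree_point:
  fixes P :: "'a::{field,finite} \<times> 'a \<times> 'a"
  assumes "7 \<le> CARD('a)"
  shows "rich_degree (Inl P) \<le> 2"
proof -
  obtain a b c where P: "P = (a, b, c)" by (cases P)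
  have "{v. rich (Inl P) v} \<subseteq> {Inr (0, 0, - c), Inr (0, 1, 1 + b - c)}"
  proof
    fix v assume v: "v \<in> {v. rich (Inl P) v}"
    then obtain x y z where "v = Inr (x, y, z)" by (cases v) auto
    then show "v \<in> {Inr (0, 0, - c), Inr (0, 1, 1 + b - c)}"
      using v by (auto simp: P rich_point_line_iff[OF assms])
  qed
  then have "card {v. rich (Inl P) v} \<le> card {Inr (0, 0, - c), Inr (0, 1, 1 + b - c) :: 'a vertex}"
    by (intro card_mono) auto
  also have "\<dots> \<le> 2" by (simp add: card_insert_if)
  finally show ?thesis by (simp add: rich_degree_def)
qed

lemma rich_degree_line_eq_0:
  fixes x y z :: "'a::{field,finite}"
  assumes "7 \<le> CARD('a)" and "\<not> (x = 0 \<and> (y = 0 \<or> y = 1))"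
  shows "rich_degree (Inr (x, y, z)) = 0"
proof -
  have "\<not> rich (Inr (x, y, z)) v" for v
  proof (cases v)
    case (Inl P)
    then show ?thesis using assms
      by (cases P) (simp add: rich_sym[of "Inr _"] rich_point_line_iff[OF assms(1)])
  qed simp
  then show ?thesis by (simp add: rich_degree_def)
qed

text \<open>With \<open>a = 0\<close> every nonzero \<open>b\<close> qualifies. With
  \<open>a\<close> and \<open>b\<close> nonzero, \<open>\<mu> a b = 0\<close> means
  \<open>b = - a / (1 + a)\<close>, which needs \<open>a \<noteq> -1\<close>. This gives
  \<open>CARD('a) - 1\<close> and \<open>CARD('a) - 2\<close> points.\<close>

lemma rich_degree_line_00:
  fixes z :: "'a::{field,finite}"
  assumes "7 \<le> CARD('a)"
  shows "2 * CARD('a) - 3 \<le> rich_degree (Inr (0, 0, z))"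
proof -
  define S1 :: "'a vertex set" where "S1 = (\<lambda>b. Inl (0, b, - z)) ` (UNIV - {0})"
  define S2 :: "'a vertex set" where "S2 = (\<lambda>a. Inl (a, - a / (1 + a), - z)) ` (UNIV - {0, -1})"
  have "S1 \<union> S2 \<subseteq> {v. rich (Inr (0, 0, z)) v}"
  proof
    fix v assume "v \<in> S1 \<union> S2"
    then consider b where "v = Inl (0, b, - z)" "b \<noteq> 0"
      | a where "v = Inl (a, - a / (1 + a), - z)" "a \<noteq> 0" "a \<noteq> -1"
      by (auto simp: S1_def S2_def)
    then show "v \<in> {v. rich (Inr (0, 0, z)) v}"
    proof cases
      case 1
      then show ?thesis by (simp add: rich_sym[of "Inr _"] rich_point_line_iff[OF assms])
    next
      case 2
      have "1 + a \<noteq> 0" using 2(3) by (metis add.commute add_eq_0_iff)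
      then have "\<mu> a (- a / (1 + a)) = 0" by (simp add: \<mu>_def field_simps)
      then show ?thesis using 2 \<open>1 + a \<noteq> 0\<close>
        by (simp add: rich_sym[of "Inr _"] rich_point_line_iff[OF assms])
    qed
  qed
  then have "card (S1 \<union> S2) \<le> rich_degree (Inr (0, 0, z))"
    unfolding rich_degree_def by (intro card_mono) auto
  moreover have "card (S1 \<union> S2) = card S1 + card S2"
    by (intro card_Un_disjoint) (auto simp: S1_def S2_def)
  moreover have "card S1 = CARD('a) - 1" unfolding S1_def
    by (subst card_image) (auto simp: inj_on_def card_Diff_subset)
  moreover have "card S2 = CARD('a) - 2" unfolding S2_def
    by (subst card_image) (auto simp: inj_on_def card_Diff_subset)
  ultimately show ?thesis using assms by linarith
qed

text \<open>Here \<open>\<mu> a b - 1 = (b + 1) * (b * (1 + a) - 1)\<close>, so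
  \<open>a \<noteq> 0\<close> leaves \<open>b = 1 / (1 + a)\<close>. Besides \<open>a = -1\<close>,
  also \<open>a = -2\<close> is lost, as it would give \<open>b = -1\<close>. Since
  \<open>2 \<noteq> 0\<close>, this is a further value, and the count falls one short of that for
  \<open>[0, 0, z]\<close>.\<close>

lemma rich_degree_line_01:
  fixes z :: "'a::{field,finite}"
  assumes "7 \<le> CARD('a)" and two: "(2::'a) \<noteq> 0"
  shows "3 \<le> rich_degree (Inr (0, 1, z))" and "rich_degree (Inr (0, 1, z)) < 2 * CARD('a) - 3"
proof -
  define S1 :: "'a vertex set" where "S1 = (\<lambda>b. Inl (0, b, 1 + b - z)) ` (UNIV - {-1})"
  define S2 :: "'a vertex set"
    where "S2 = (\<lambda>a. Inl (a, 1 / (1 + a), 1 + 1 / (1 + a) - z)) ` (UNIV - {0, -1, -2})"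
  have card1: "card S1 = CARD('a) - 1" unfolding S1_def
    by (subst card_image) (auto simp: inj_on_def card_Diff_subset)
  have "S1 \<subseteq> {v. rich (Inr (0, 1, z)) v}"
    by (auto simp: S1_def rich_sym[of "Inr _"] rich_point_line_iff[OF assms(1)])
  then have "card S1 \<le> rich_degree (Inr (0, 1, z))"
    unfolding rich_degree_def by (intro card_mono) auto
  then show "3 \<le> rich_degree (Inr (0, 1, z))" using card1 assms by linarith
  have "{v. rich (Inr (0, 1, z)) v} \<subseteq> S1 \<union> S2"
  proof
    fix v assume v: "v \<in> {v. rich (Inr (0, 1, z)) v}"
    then obtain a b c where abc: "v = Inl (a, b, c)" by (cases v) auto
    then have b: "b \<noteq> -1" and m: "a * \<mu> a b = a" and c: "c = 1 + b - z"
      using v by (auto simp: rich_sym[of "Inr _"] rich_point_line_iff[OF assms(1)])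
    show "v \<in> S1 \<union> S2"
    proof (cases "a = 0")
      case True
      then show ?thesis using abc b c by (auto simp: S1_def)
    next
      case False
      then have "\<mu> a b = 1" using m by simp
      then have "(b + 1) * (b * (1 + a) - 1) = 0" by (simp add: \<mu>_def algebra_simps)
      moreover have "b + 1 \<noteq> 0" using b by (metis add_eq_0_iff2)
      ultimately have ba: "b * (1 + a) = 1" by simp
      then have "1 + a \<noteq> 0" by auto
      then have "b = 1 / (1 + a)" using ba by (simp add: field_simps)
      moreover have "a \<noteq> -1" using \<open>1 + a \<noteq> 0\<close> by auto
      moreover have "a \<noteq> -2"
      proof
        assume "a = -2"
        then have "b * (-1) = 1" using ba by simp
        then show False using b by (metis minus_minus mult_minus1_right)
      qed
      ultimately show ?thesis using abc c False by (auto simp: S2_def)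
    qed
  qed
  then have "rich_degree (Inr (0, 1, z)) \<le> card (S1 \<union> S2)"
    unfolding rich_degree_def by (intro card_mono) auto
  also have "\<dots> \<le> card S1 + card S2" by (rule card_Un_le)
  also have "card S2 \<le> CARD('a) - 3"
  proof -
    have "(1::'a) \<noteq> 2" by (metis add_cancel_right_right one_add_one zero_neq_one)
    then have "card {0, -1, -2 :: 'a} = 3"
      using two by (simp add: card_insert_if)
    then have "card (UNIV - {0, -1, -2 :: 'a}) = CARD('a) - 3"
      by (subst card_Diff_subset) auto
    moreover have "card S2 \<le> card (UNIV - {0, -1, -2 :: 'a})"
      unfolding S2_def by (rule card_image_le) simp
    ultimately show ?thesis by simp
  qed
  finally show "rich_degree (Inr (0, 1, z)) < 2 * CARD('a) - 3"
    using card1 assms(1) by linarith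
qed

text \<open>Points have rich degree at most 2 and all other lines have 0, so the two thresholds
  single out the two families by a quantity that automorphisms preserve.\<close>

lemma rich_degree_characterizes_lines:
  fixes v :: "'a::{field,finite} vertex"
  assumes "7 \<le> CARD('a)" and "(2::'a) \<noteq> 0"
  shows "2 * CARD('a) - 3 \<le> rich_degree v \<longleftrightarrow> (\<exists>z. v = Inr (0, 0, z))"
    and "3 \<le> rich_degree v \<and> rich_degree v < 2 * CARD('a) - 3 \<longleftrightarrow> (\<exists>z. v = Inr (0, 1, z))"
proof -
  consider P where "v = Inl P" | z where "v = Inr (0, 0, z)" | z where "v = Inr (0, 1, z)"
    | x y z where "v = Inr (x, y, z)" "\<not> (x = 0 \<and> (y = 0 \<or> y = 1))"
    by (metis surj_pair sum.exhaust)
  then have "(2 * CARD('a) - 3 \<le> rich_degree v \<longleftrightarrow> (\<exists>z. v = Inr (0, 0, z))) \<and>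
    (3 \<le> rich_degree v \<and> rich_degree v < 2 * CARD('a) - 3 \<longleftrightarrow> (\<exists>z. v = Inr (0, 1, z)))"
  proof cases
    case (1 P)
    then show ?thesis using rich_degree_point[OF assms(1), of P] assms(1) by simp
  next
    case (2 z)
    then show ?thesis using rich_degree_line_00[OF assms(1), of z] by simp
  next
    case (3 z)
    then show ?thesis using rich_degree_line_01[OF assms, of z] by simp
  next
    case (4 x y z)
    then show ?thesis using rich_degree_line_eq_0[OF assms(1) 4(2), of z] assms(1) by auto
  qed
  then show "2 * CARD('a) - 3 \<le> rich_degree v \<longleftrightarrow> (\<exists>z. v = Inr (0, 0, z))"
    and "3 \<le> rich_degree v \<and> rich_degree v < 2 * CARD('a) - 3 \<longleftrightarrow> (\<exists>z. v = Inr (0, 1, z))"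
    by blast+
qed


section \<open>Automorphisms\<close>

lemma graph_automorphisms_Gamma_iff:
  "\<phi> \<in> graph_automorphisms (Gamma f g) \<longleftrightarrow>
    bij \<phi> \<and> (\<forall>u v. (\<phi> u, \<phi> v) \<in> parcs (Gamma f g) \<longleftrightarrow> (u, v) \<in> parcs (Gamma f g))"
  by (simp add: graph_automorphisms_def Gamma_def Bij_def)

lemma aut_iff:
  "\<phi> \<in> graph_automorphisms graph_R \<longleftrightarrow> bij \<phi> \<and> (\<forall>u v. adj (\<phi> u) (\<phi> v) \<longleftrightarrow> adj u v)"
  by (simp add: graph_automorphisms_Gamma_iff adj_def)

lemma aut_rich:
  assumes "\<phi> \<in> graph_automorphisms graph_R"
  shows "rich (\<phi> u) (\<phi> v) \<longleftrightarrow> rich u v"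
proof -
  have b: "bij \<phi>" and adj: "\<And>u v. adj (\<phi> u) (\<phi> v) \<longleftrightarrow> adj u v"
    using assms by (auto simp: aut_iff)
  have "paths3 (\<phi> u) (\<phi> v) = map_prod \<phi> \<phi> ` paths3 u v"
  proof (intro subset_antisym subsetI)
    fix q assume q: "q \<in> paths3 (\<phi> u) (\<phi> v)"
    obtain n w where "q = (\<phi> n, \<phi> w)"
      using b by (metis bij_pointE surj_pair)
    then show "q \<in> map_prod \<phi> \<phi> ` paths3 u v"
      using q adj by (force simp: paths3_def)
  qed (auto simp: paths3_def adj)
  moreover have "inj_on (map_prod \<phi> \<phi>) (paths3 u v)"
    using bij_is_inj[OF b] by (auto simp: inj_on_def dest: injD)
  ultimately have "card (paths3 (\<phi> u) (\<phi> v)) = card (paths3 u v)"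
    by (simp add: card_image)
  then show ?thesis by (simp add: rich_def adj)
qed

lemma aut_rich_degree:
  assumes "\<phi> \<in> graph_automorphisms graph_R"
  shows "rich_degree (\<phi> u) = rich_degree u"
proof -
  have b: "bij \<phi>" using assms by (simp add: aut_iff)
  have "{v. rich (\<phi> u) v} = \<phi> ` {v. rich u v}"
  proof (intro subset_antisym subsetI)
    fix v assume v: "v \<in> {v. rich (\<phi> u) v}"
    obtain w where "v = \<phi> w" using b by (metis bij_pointE)
    then show "v \<in> \<phi> ` {v. rich u v}" using v aut_rich[OF assms] by blast
  qed (auto simp: aut_rich[OF assms])
  moreover have "inj_on \<phi> {v. rich u v}" using b by (meson bij_is_inj inj_on_subset subset_UNIV)
  ultimately show ?thesis by (simp add: rich_degree_def card_image)
qed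

text \<open>
  Joined by an edge or a rich pair. The points near both a line \<open>[0, 0, z]\<close> and a line \<open>[0, 1, z']\<close>
  are exactly those with first coordinate \<open>0\<close>.
\<close>

definition near :: "'a::{field,finite} vertex \<Rightarrow> 'a vertex \<Rightarrow> bool" where
  "near u v \<longleftrightarrow> adj u v \<or> rich u v"

text \<open>Adjacency supplies exactly the points with \<open>b = 0\<close> that richness excludes,
  so the condition becomes uniform in \<open>b\<close>. For \<open>[0, 1, z]\<close> the same
  happens with \<open>b = -1\<close>.\<close>

lemma near_line_00_iff:
  fixes u :: "'a::{field,finite} vertex"
  assumes "7 \<le> CARD('a)"
  shows "near u (Inr (0, 0, z)) \<longleftrightarrow> (\<exists>a b. u = Inl (a, b, - z) \<and> a * \<mu> a b = 0)"
proof (cases u)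
  case (Inl P)
  obtain a b c where "P = (a, b, c)" by (cases P)
  with Inl show ?thesis
    by (auto simp: near_def rich_point_line_iff[OF assms] add_eq_0_iff2 \<mu>_def)
qed (auto simp: near_def)

lemma near_line_01_iff:
  fixes u :: "'a::{field,finite} vertex"
  assumes "7 \<le> CARD('a)"
  shows "near u (Inr (0, 1, z)) \<longleftrightarrow> (\<exists>a b. u = Inl (a, b, 1 + b - z) \<and> a * \<mu> a b = a)"
proof (cases u)
  case (Inl P)
  obtain a b c where "P = (a, b, c)" by (cases P)
  moreover have "z = 1 + b - c \<longleftrightarrow> c = 1 + b - z" by (auto simp: algebra_simps)
  moreover have "a * \<mu> a (-1) = a" by (simp add: \<mu>_def)
  ultimately show ?thesis using Inl
    by (auto simp: near_def rich_point_line_iff[OF assms] add_eq_0_iff2)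
qed (auto simp: near_def)

text \<open>
  The point \<open>(0, b, c)\<close> is determined by the two lines \<open>[0, 0, - c]\<close> and \<open>[0, 1, 1 - (c - b)]\<close> near it.
  It is adjacent to the first iff \<open>b = 0\<close> and to the second iff \<open>b = - 1\<close>; this forces the
  permutations of the parameters \<open>c\<close> and \<open>c - b\<close> to coincide and to commute with \<open>c \<mapsto> c + 1\<close>.
\<close>

lemma aut_axis_shift:
  fixes \<phi> :: "'a::{field,finite} vertex \<Rightarrow> 'a vertex"
  assumes prime: "prime CARD('a)" and card7: "7 \<le> CARD('a)"
    and aut: "\<phi> \<in> graph_automorphisms graph_R"
  obtains s where "\<And>b c. \<phi> (Inl (0, b, c)) = Inl (0, b, c + s)"
proof -
  have adj: "\<And>u v. adj (\<phi> u) (\<phi> v) \<longleftrightarrow> adj u v"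
    using aut by (auto simp: aut_iff)
  have two: "(2::'a) \<noteq> 0"
  proof
    assume "(2::'a) = 0"
    then have "of_nat 2 = (0::'a)" by simp
    then have "CHAR('a) dvd 2" by (simp only: of_nat_eq_0_iff_char_dvd)
    then have "CARD('a) \<le> 2" using CHAR_eq_CARD[OF prime] by (intro dvd_imp_le) auto
    then show False using card7 by simp
  qed
  have near: "near (\<phi> u) (\<phi> v) \<longleftrightarrow> near u v" for u v
    by (simp add: near_def adj aut_rich[OF aut])
  have "\<exists>c'. \<phi> (Inr (0, 0, - c)) = Inr (0, 0, - c')" for c
  proof -
    obtain z where "\<phi> (Inr (0, 0, - c)) = Inr (0, 0, z)"
      using rich_degree_characterizes_lines(1)[OF card7 two, of "Inr (0, 0, - c)"]
        rich_degree_characterizes_lines(1)[OF card7 two, of "\<phi> (Inr (0, 0, - c))"]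
        aut_rich_degree[OF aut] by auto
    then have "\<phi> (Inr (0, 0, - c)) = Inr (0, 0, - (- z))" by simp
    then show ?thesis by blast
  qed
  then obtain \<sigma> where \<sigma>: "\<And>c. \<phi> (Inr (0, 0, - c)) = Inr (0, 0, - \<sigma> c)" by metis
  have "\<exists>t'. \<phi> (Inr (0, 1, 1 - t)) = Inr (0, 1, 1 - t')" for t
  proof -
    obtain z where "\<phi> (Inr (0, 1, 1 - t)) = Inr (0, 1, z)"
      using rich_degree_characterizes_lines(2)[OF card7 two, of "Inr (0, 1, 1 - t)"]
        rich_degree_characterizes_lines(2)[OF card7 two, of "\<phi> (Inr (0, 1, 1 - t))"]
        aut_rich_degree[OF aut] by auto
    then have "\<phi> (Inr (0, 1, 1 - t)) = Inr (0, 1, 1 - (1 - z))" by simp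
    then show ?thesis by blast
  qed
  then obtain \<tau> where \<tau>: "\<And>t. \<phi> (Inr (0, 1, 1 - t)) = Inr (0, 1, 1 - \<tau> t)" by metis
  have axis: "\<phi> (Inl (0, b, c)) = Inl (0, \<sigma> c - \<tau> (c - b), \<sigma> c)" for b c
  proof -
    have "near (Inl (0, b, c)) (Inr (0, 0, - c))"
      by (simp add: near_line_00_iff[OF card7])
    then have "near (\<phi> (Inl (0, b, c))) (Inr (0, 0, - \<sigma> c))"
      using near \<sigma> by metis
    then obtain a' b' where eq: "\<phi> (Inl (0, b, c)) = Inl (a', b', \<sigma> c)" and 0: "a' * \<mu> a' b' = 0"
      by (auto simp: near_line_00_iff[OF card7])
    have "near (Inl (0, b, c)) (Inr (0, 1, 1 - (c - b)))"
      by (simp add: near_line_01_iff[OF card7])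
    then have "near (\<phi> (Inl (0, b, c))) (Inr (0, 1, 1 - \<tau> (c - b)))"
      using near \<tau> by metis
    then have "a' * \<mu> a' b' = a'" and "\<sigma> c = 1 + b' - (1 - \<tau> (c - b))"
      by (auto simp: near_line_01_iff[OF card7] eq)
    then show ?thesis using eq 0 by (simp add: algebra_simps)
  qed
  have "adj (Inl (0, 0, c)) (Inr (0, 0, - c))" for c :: 'a by simp
  then have "adj (\<phi> (Inl (0, 0, c))) (\<phi> (Inr (0, 0, - c)))" for c by (simp only: adj)
  then have \<sigma>\<tau>: "\<sigma> c = \<tau> c" for c by (simp add: axis \<sigma>)
  \<comment> \<open>For \<open>b = -1\<close> the parameter \<open>c - b\<close> is
    \<open>c + 1\<close>; adjacency of the images says
    \<open>\<sigma> c - \<tau> (c + 1) = -1\<close>.\<close>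
  have "adj (Inl (0, -1, c)) (Inr (0, 1, 1 - (c + 1)))" for c :: 'a by simp
  then have "adj (\<phi> (Inl (0, -1, c))) (\<phi> (Inr (0, 1, 1 - (c + 1))))" for c by (simp only: adj)
  then have step: "\<sigma> (c + 1) = \<sigma> c + 1" for c
    unfolding \<sigma>\<tau> \<tau> axis by (simp add: algebra_simps \<sigma>\<tau>)
  have "\<sigma> (of_nat n) = of_nat n + \<sigma> 0" for n
  proof (induction n)
    case (Suc n)
    have "\<sigma> (of_nat (Suc n)) = \<sigma> (of_nat n) + 1" using step[of "of_nat n"] by (simp add: add.commute)
    then show ?case using Suc by simp
  qed simp
  then have shift: "\<sigma> c = c + \<sigma> 0" for c
    using prime_field_of_nat[OF prime, of c] by blast
  have "\<phi> (Inl (0, b, c)) = Inl (0, b, c + \<sigma> 0)" for b c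
    using shift[of c] shift[of "c - b"] by (simp add: axis \<sigma>\<tau>[symmetric])
  then show thesis by (rule that)
qed

text \<open>Only a cubic, not a linear, polynomial has a nonzero power sum of exponent \<open>(CARD('a) - 1) / 3\<close>.\<close>

lemma sum_\<mu>_power:
  fixes x y :: "'a::{field,finite}"
  assumes k: "3 * k = CARD('a) - 1" "0 < k"
  shows "(\<Sum>a\<in>UNIV. \<mu> a (a * x - y) ^ k) = - ((x\<^sup>2) ^ k)"
proof -
  \<comment> \<open>The coefficients of \<open>\<mu> a (a * x - y)\<close> in \<open>a\<close>.
    Since \<open>3 * k = CARD('a) - 1\<close>, the cubic term alone decides the coefficient of
    \<open>q ^ k\<close> picked out by \<open>sum_poly_UNIV\<close>.\<close>
  define q where "q = [: y\<^sup>2, y\<^sup>2 - y - 2 * x * y, x\<^sup>2 + x - 2 * x * y, x\<^sup>2 :]"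
  have "poly q a = \<mu> a (a * x - y)" for a
    unfolding q_def \<mu>_def by (simp add: algebra_simps power2_eq_square)
  then have "(\<Sum>a\<in>UNIV. \<mu> a (a * x - y) ^ k) = (\<Sum>a\<in>UNIV. poly (q ^ k) a)"
    by (simp add: poly_power)
  also have "\<dots> = - Polynomial.coeff (q ^ k) (CARD('a) - 1)"
  proof (rule sum_poly_UNIV)
    have "Polynomial.degree q \<le> 3" by (simp add: q_def degree_pCons_eq_if)
    then show "Polynomial.degree (q ^ k) \<le> CARD('a) - 1"
      using degree_power_le[of q k] k by (metis mult_le_mono1 order_trans)
  qed
  also have "Polynomial.coeff (q ^ k) (CARD('a) - 1) = (x\<^sup>2) ^ k"
  proof (cases "x = 0")
    case True
    then have "Polynomial.degree q \<le> 1" by (simp add: q_def degree_pCons_eq_if)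
    then have "Polynomial.degree (q ^ k) \<le> k"
      using degree_power_le[of q k] by (metis mult_1 mult_le_mono1 order_trans)
    then have "Polynomial.coeff (q ^ k) (CARD('a) - 1) = 0"
      using k by (intro coeff_eq_0) linarith
    then show ?thesis using True k by simp
  next
    case False
    then have "Polynomial.degree q = 3" by (simp add: q_def)
    then have "Polynomial.degree (q ^ k) = CARD('a) - 1"
      using k degree_power_eq[of q k] by (cases "q = 0") auto
    moreover have "lead_coeff (q ^ k) = lead_coeff q ^ k" by (rule lead_coeff_power)
    moreover have "lead_coeff q = x\<^sup>2" using False by (simp add: q_def)
    ultimately show ?thesis by simp
  qed
  finally show ?thesis .
qed

text \<open>The axis pins down the last two coordinates of every line, and a weighted count detects
  \<open>x = 0\<close>. The lines \<open>[0, y, z]\<close> pin down the last two coordinates of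
  every point, and the invariance of \<open>\<mu>\<close> then recovers most first coordinates;
  incidence recovers the rest.\<close>

lemma aut_fixing_axis_eq_id:
  fixes \<psi> :: "'a::{field,finite} vertex \<Rightarrow> 'a vertex"
  assumes card7: "7 \<le> CARD('a)" and cong: "3 dvd CARD('a) - 1"
    and aut: "\<psi> \<in> graph_automorphisms graph_R"
    and axis: "\<And>b c. \<psi> (Inl (0, b, c)) = Inl (0, b, c)"
  shows "\<psi> = id"
proof -
  have bij: "bij \<psi>" and adj: "\<And>u v. adj (\<psi> u) (\<psi> v) \<longleftrightarrow> adj u v"
    using aut by (auto simp: aut_iff)
  have line: "\<exists>x'. \<psi> (Inr (x, y, z)) = Inr (x', y, z)" for x y z
  proof -
    \<comment> \<open>This fixed point lies on the line and its image, and determines the last two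
      coordinates of both.\<close>
    have "adj (Inl (0, - y, - z)) (Inr (x, y, z))" by simp
    then have "adj (Inl (0, - y, - z)) (\<psi> (Inr (x, y, z)))"
      by (metis adj axis)
    then show ?thesis by (cases "\<psi> (Inr (x, y, z))") auto
  qed
  have point: "\<exists>a' b' c'. \<psi> (Inl (a, b, c)) = Inl (a', b', c')" for a b c
  proof -
    have "adj (Inl (a, b, c)) (Inr (0, - b, - c))" by simp
    then have "adj (\<psi> (Inl (a, b, c))) (\<psi> (Inr (0, - b, - c)))" by (simp only: adj)
    then show ?thesis using line[of 0 "- b" "- c"]
      by (cases "\<psi> (Inl (a, b, c))") auto
  qed
  have \<mu>_inv: "\<mu> a' b' = \<mu> a b" if im: "\<psi> (Inl (a, b, c)) = Inl (a', b', c')" for a b c a' b' c'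
  proof (cases "a' = 0")
    case True
    \<comment> \<open>An image on the axis is itself fixed, so injectivity makes it equal to the
      original point.\<close>
    then have "\<psi> (Inl (a, b, c)) = \<psi> (Inl (a', b', c'))" using im axis by simp
    then show ?thesis using bij by (simp add: bij_is_inj inj_eq)
  next
    case False
    have lines: "\<exists>x'. b' + (a * x - b) = a' * x' \<and> c' + (a * x * \<mu> a b - c) = a' * x' * \<mu> a' b'" for x
    proof -
      obtain x' where x': "\<psi> (Inr (x, a * x - b, a * x * \<mu> a b - c)) = Inr (x', a * x - b, a * x * \<mu> a b - c)"
        using line by blast
      have "adj (Inl (a, b, c)) (Inr (x, a * x - b, a * x * \<mu> a b - c))" by simp
      then have "adj (\<psi> (Inl (a, b, c))) (\<psi> (Inr (x, a * x - b, a * x * \<mu> a b - c)))"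
        by (simp only: adj)
      then show ?thesis unfolding im x' by auto
    qed
    \<comment> \<open>Subtracting the equations for the lines with \<open>x = 0\<close> and
      \<open>x = 1\<close> cancels the coordinates \<open>b\<close>, \<open>b'\<close>,
      \<open>c\<close>, \<open>c'\<close> outside \<open>\<mu>\<close>; the ratio of the two
      differences is the \<open>\<mu>\<close> value.\<close>
    obtain x0 where x0: "b' - b = a' * x0" "c' - c = a' * x0 * \<mu> a' b'"
      using lines[of 0] by auto
    obtain x1 where x1: "b' + (a - b) = a' * x1" "c' + (a * \<mu> a b - c) = a' * x1 * \<mu> a' b'"
      using lines[of 1] by auto
    have "a = a' * (x1 - x0)" using x0(1) x1(1) by (simp add: algebra_simps)
    moreover have "a * \<mu> a b = a' * (x1 - x0) * \<mu> a' b'"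
      using x0(2) x1(2) by (simp add: algebra_simps)
    ultimately have "a * \<mu> a b = a * \<mu> a' b'" by simp
    moreover have "a \<noteq> 0" using False im axis by auto
    ultimately show ?thesis by simp
  qed
  obtain k where k: "3 * k = CARD('a) - 1" using cong by (metis dvd_def)
  then have "0 < k" using card7 by linarith
  define pts where "pts L = {v. adj v (Inr L)}" for L :: "'a \<times> 'a \<times> 'a"
  \<comment> \<open>By \<open>\<mu>_inv\<close> this weight is invariant on points; its value on
    lines is a dummy. Its sum over the points of a line depends only on \<open>x\<close> and
    vanishes just for \<open>x = 0\<close>.\<close>
  define wt where "wt v = (case v of Inl (a, b, c) \<Rightarrow> \<mu> a b ^ k | Inr _ \<Rightarrow> 0)" for v :: "'a vertex"
  have sum_pts: "(\<Sum>v\<in>pts (x, y, z). wt v) = - ((x\<^sup>2) ^ k)" for x y z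
  proof -
    let ?f = "\<lambda>a. Inl (a, a * x - y, a * x * \<mu> a (a * x - y) - z) :: 'a vertex"
    have "pts (x, y, z) = range ?f"
    proof (intro subset_antisym subsetI)
      fix v assume v: "v \<in> pts (x, y, z)"
      then obtain a b c where abc: "v = Inl (a, b, c)" by (cases v) (auto simp: pts_def)
      then have b: "b = a * x - y" and "c = a * x * \<mu> a b - z"
        using v by (auto simp: pts_def algebra_simps)
      then have "v = ?f a" using abc by simp
      then show "v \<in> range ?f" by blast
    qed (auto simp: pts_def)
    moreover have "inj ?f" by (auto simp: inj_def)
    ultimately have "(\<Sum>v\<in>pts (x, y, z). wt v) = (\<Sum>a\<in>UNIV. wt (?f a))"
      by (simp add: sum.reindex)
    then show ?thesis using sum_\<mu>_power[OF k \<open>0 < k\<close>, of x y] by (simp add: wt_def)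
  qed
  have line0: "\<psi> (Inr (0, y, z)) = Inr (0, y, z)" for y z
  proof -
    obtain x' where x': "\<psi> (Inr (0, y, z)) = Inr (x', y, z)" using line by blast
    have "pts (x', y, z) = \<psi> ` pts (0, y, z)"
    proof (intro subset_antisym subsetI)
      fix v assume v: "v \<in> pts (x', y, z)"
      obtain w where "v = \<psi> w" using bij by (metis bij_pointE)
      then show "v \<in> \<psi> ` pts (0, y, z)"
        using v adj[of w "Inr (0, y, z)"] x' by (auto simp: pts_def)
    next
      fix v assume "v \<in> \<psi> ` pts (0, y, z)"
      then obtain w where "v = \<psi> w" "adj w (Inr (0, y, z))" by (auto simp: pts_def)
      then show "v \<in> pts (x', y, z)"
        using adj[of w "Inr (0, y, z)"] x' by (simp add: pts_def)
    qed
    moreover have "inj_on \<psi> (pts (0, y, z))"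
      using bij by (meson bij_is_inj inj_on_subset subset_UNIV)
    ultimately have "(\<Sum>v\<in>pts (x', y, z). wt v) = (\<Sum>v\<in>pts (0, y, z). wt (\<psi> v))"
      by (simp add: sum.reindex)
    also have "\<dots> = (\<Sum>v\<in>pts (0, y, z). wt v)"
    proof (rule sum.cong[OF refl])
      fix v assume "v \<in> pts (0, y, z)"
      then obtain a b c where v: "v = Inl (a, b, c)" by (cases v) (auto simp: pts_def)
      obtain a' b' c' where im: "\<psi> v = Inl (a', b', c')" using point v by blast
      then show "wt (\<psi> v) = wt v" using \<mu>_inv v by (simp add: wt_def)
    qed
    finally have "(x'\<^sup>2) ^ k = (0\<^sup>2) ^ k" unfolding sum_pts by simp
    then have "x' = 0" using \<open>0 < k\<close> by (simp add: power_0_left)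
    then show ?thesis using x' by simp
  qed
  have point_bc: "\<exists>a'. \<psi> (Inl (a, b, c)) = Inl (a', b, c)" for a b c
  proof -
    obtain a' b' c' where im: "\<psi> (Inl (a, b, c)) = Inl (a', b', c')" using point by blast
    have "adj (Inl (a, b, c)) (Inr (0, - b, - c))" by simp
    then have "adj (\<psi> (Inl (a, b, c))) (\<psi> (Inr (0, - b, - c)))" by (simp only: adj)
    then show ?thesis unfolding im line0 by auto
  qed
  have generic: "\<psi> (Inl (a, b, c)) = Inl (a, b, c)" if "b \<noteq> 0" "b \<noteq> -1" for a b c
  proof -
    obtain a' where im: "\<psi> (Inl (a, b, c)) = Inl (a', b, c)" using point_bc by blast
    \<comment> \<open>For fixed \<open>b\<close>, \<open>\<mu> a b\<close> is affine in
      \<open>a\<close> with slope \<open>b * (b + 1)\<close>, hence injective unless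
      \<open>b\<close> is 0 or -1.\<close>
    have "(a' - a) * (b * (b + 1)) = \<mu> a' b - \<mu> a b" by (simp add: \<mu>_def algebra_simps)
    also have "\<dots> = 0" using \<mu>_inv[OF im] by simp
    finally have "a' = a" using that by (auto simp: add_eq_0_iff2)
    then show ?thesis using im by simp
  qed
  have line_fixed: "\<psi> (Inr (x, y, z)) = Inr (x, y, z)" for x y z
  proof (cases "x = 0")
    case True
    then show ?thesis using line0 by simp
  next
    case False
    \<comment> \<open>A point of the line with \<open>b\<close> outside this set is fixed by
      \<open>generic\<close>, and \<open>b \<noteq> - y\<close> makes its first coordinate nonzero,
      so it determines \<open>x\<close>.\<close>
    have "card {0, -1, - y} \<le> 3" by (simp add: card_insert_if)
    then have "{0, -1, - y} \<noteq> UNIV" using card7 by auto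
    then obtain b where b: "b \<noteq> 0" "b \<noteq> -1" "b \<noteq> - y" by blast
    define a where "a = (b + y) / x"
    have a: "b + y = a * x" "a \<noteq> 0" using b False by (auto simp: a_def add_eq_0_iff2)
    obtain x' where x': "\<psi> (Inr (x, y, z)) = Inr (x', y, z)" using line by blast
    let ?P = "Inl (a, b, a * x * \<mu> a b - z) :: 'a vertex"
    have "adj ?P (Inr (x, y, z))" using a by simp
    then have "adj (\<psi> ?P) (\<psi> (Inr (x, y, z)))" by (simp only: adj)
    then have "a * x = a * x'" unfolding generic[OF b(1,2)] x' using a by simp
    then show ?thesis using a x' by simp
  qed
  have point_fixed: "\<psi> (Inl (a, b, c)) = Inl (a, b, c)" for a b c
  proof -
    obtain a' where im: "\<psi> (Inl (a, b, c)) = Inl (a', b, c)" using point_bc by blast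
    \<comment> \<open>A fixed line through the point whose first coordinate 1 lets incidence read
      off \<open>a' = a\<close>.\<close>
    let ?L = "Inr (1, a - b, a * \<mu> a b - c) :: 'a vertex"
    have "adj (Inl (a, b, c)) ?L" by simp
    then have "adj (\<psi> (Inl (a, b, c))) (\<psi> ?L)" by (simp only: adj)
    then show ?thesis unfolding im line_fixed by simp
  qed
  show ?thesis
  proof
    fix v show "\<psi> v = id v"
      by (cases v) (auto simp: point_fixed line_fixed)
  qed
qed

section \<open>Translations and the comparison of automorphism groups\<close>

definition translation :: "'a::{field,finite} \<Rightarrow> 'a \<Rightarrow> 'a vertex \<Rightarrow> 'a vertex" where
  "translation t s v = (case v of Inl (a, b, c) \<Rightarrow> Inl (a, b + t, c + s)
    | Inr (x, y, z) \<Rightarrow> Inr (x, y - t, z - s))"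

lemma translation_simps [simp]:
  "translation t s (Inl (a, b, c)) = Inl (a, b + t, c + s)"
  "translation t s (Inr (x, y, z)) = Inr (x, y - t, z - s)"
  by (simp_all add: translation_def)

lemma translation_uminus_cancel: "translation t s (translation (- t) (- s) v) = v"
  by (cases v) auto

lemma bij_translation: "bij (translation t s)"
  by (rule bij_betw_byWitness[where f' = "translation (- t) (- s)"])
    (use translation_uminus_cancel[of t s] translation_uminus_cancel[of "- t" "- s"] in auto)

lemma translation_eq_iff: "translation t s = translation t' s' \<longleftrightarrow> t = t' \<and> s = s'"
proof
  assume "translation t s = translation t' s'"
  then have "translation t s (Inl (0, 0, 0)) = translation t' s' (Inl (0, 0, 0))" by simp
  then show "t = t' \<and> s = s'" by simp
qed simp

lemma translation_aut_R: "translation 0 s \<in> graph_automorphisms graph_R"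
proof -
  have "adj (translation 0 s u) (translation 0 s v) \<longleftrightarrow> adj u v" for u v
    by (cases u; cases v) auto
  then show ?thesis by (simp add: aut_iff bij_translation)
qed

text \<open>Undoing the shift on the axis by a translation leaves an automorphism that fixes the
  axis pointwise, hence the identity.\<close>

lemma graph_automorphisms_R:
  assumes "prime CARD('a::{field,finite})" and "7 \<le> CARD('a)" and "3 dvd CARD('a) - 1"
  shows "graph_automorphisms (graph_R :: 'a vertex pair_pre_digraph) = range (translation 0)"
proof (intro subset_antisym subsetI)
  fix \<phi> :: "'a vertex \<Rightarrow> 'a vertex"
  assume aut: "\<phi> \<in> graph_automorphisms graph_R"
  then obtain s where s: "\<And>b c. \<phi> (Inl (0, b, c)) = Inl (0, b, c + s)"
    using aut_axis_shift[OF assms(1,2)] by blast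
  let ?\<psi> = "translation 0 (- s) \<circ> \<phi>"
  have "?\<psi> \<in> graph_automorphisms graph_R"
    using aut translation_aut_R[of "- s"] by (auto simp: aut_iff intro: bij_comp)
  then have "?\<psi> = id"
    by (rule aut_fixing_axis_eq_id[OF assms(2,3)]) (simp add: s)
  then have "\<phi> v = translation 0 s v" for v
    using translation_uminus_cancel[of 0 s "\<phi> v"] by (simp add: fun_eq_iff)
  then show "\<phi> \<in> range (translation 0)" by blast
qed (auto simp: translation_aut_R)

text \<open>The opposite signs on points and lines keep \<open>p2 + l2\<close> and
  \<open>p3 + l3\<close> unchanged, and \<open>h p1 l1\<close> involves no translated
  coordinate.\<close>

lemma translation_aut_Gamma_h:
  "(translation t s u, translation t s v) \<in> parcs (Gamma (\<lambda>p1 l1. p1 * l1) (\<lambda>p1 p2 l1. h p1 l1)) \<longleftrightarrow>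
    (u, v) \<in> parcs (Gamma (\<lambda>p1 l1. p1 * l1) (\<lambda>p1 p2 l1. h p1 l1))"
  by (cases u; cases v) (auto simp: Gamma_def point_line_incidence_def)

theorem theorem2p1:
  fixes p :: nat
    and R :: "('a::{field,finite} \<times> 'a \<times> 'a + 'a \<times> 'a \<times> 'a) pair_pre_digraph"
  assumes "prime p" and "[p = 1] (mod 3)" and "CARD('a) = p"
    and "R = Gamma (\<lambda>p1 l1. p1 * l1) (\<lambda>p1 p2 l1. p1 * p2 * l1 * (p1 + p2 + p1 * p2))"
  shows "Coset.order (Aut R) = p \<and>
    \<not> (\<exists>h :: 'a \<Rightarrow> 'a \<Rightarrow> 'a.
        digraph_iso (with_proj R)
          (with_proj (Gamma (\<lambda>p1 l1. p1 * l1) (\<lambda>p1 p2 l1. h p1 l1))))"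
proof -
  have "2 \<le> p" using assms(1) by (rule prime_ge_2_nat)
  have mod3: "p mod 3 = 1" using assms(2) by (simp add: cong_def)
  have dvd3: "3 dvd p - 1"
    using mod3 by (metis dvd_minus_mod)
  have "7 \<le> p"
  proof (rule ccontr)
    assume "\<not> 7 \<le> p"
    then have "p \<in> {2, 3, 4, 5, 6}" using \<open>2 \<le> p\<close> by auto
    then have "p = 4" using mod3 by auto
    moreover have "\<not> prime (4::nat)" by (simp add: prime_nat_iff) (rule exI[of _ 2], simp)
    ultimately show False using assms(1) by simp
  qed
  have auts: "graph_automorphisms R = range (translation 0)"
    using graph_automorphisms_R[where 'a='a] assms \<open>7 \<le> p\<close> dvd3 by simp
  have "inj (translation 0 :: 'a \<Rightarrow> _)" by (simp add: inj_def translation_eq_iff)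
  then have card: "card (graph_automorphisms R) = p"
    unfolding auts using assms(3) by (simp add: card_image)
  then have "Coset.order (Aut R) = p" by (simp add: Aut_def Coset.order_def)
  moreover have False
    if iso: "digraph_iso (with_proj R)
      (with_proj (Gamma (\<lambda>p1 l1. p1 * l1) (\<lambda>p1 p2 l1. h p1 l1)))" for h :: "'a \<Rightarrow> 'a \<Rightarrow> 'a"
  proof -
    let ?H = "Gamma (\<lambda>p1 l1. p1 * l1) (\<lambda>p1 p2 l1. h p1 l1)"
    have wf: "pair_wf_digraph (Gamma f g)" for f and g :: "'a \<Rightarrow> 'a \<Rightarrow> 'a \<Rightarrow> 'a"
      by unfold_locales (auto simp: Gamma_def)
    obtain \<phi> where "bij_betw \<phi> (pverts R) (pverts ?H)"
      and "\<forall>u\<in>pverts R. \<forall>v\<in>pverts R. (\<phi> u, \<phi> v) \<in> parcs ?H \<longleftrightarrow> (u, v) \<in> parcs R"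
      using iso wf unfolding assms(4) by (subst (asm) digraph_iso_with_proj_iff) blast+
    then have bij: "bij \<phi>" and adj: "\<And>u v. (\<phi> u, \<phi> v) \<in> parcs ?H \<longleftrightarrow> (u, v) \<in> parcs R"
      by (auto simp: assms(4) Gamma_def)
    \<comment> \<open>Pulling the translations back along the isomorphism embeds a set of
      \<open>p * p\<close> elements into the \<open>p\<close> automorphisms of
      \<open>R\<close>.\<close>
    define conj where "conj q = inv_into UNIV \<phi> \<circ> translation (fst q) (snd q) \<circ> \<phi>" for q
    have \<phi>_conj: "\<phi> (conj q v) = translation (fst q) (snd q) (\<phi> v)" for q v
      using bij by (simp add: conj_def bij_is_surj surj_f_inv_f)
    have "conj q \<in> graph_automorphisms R" for q
    proof -
      have "bij (conj q)" unfolding conj_def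
        using bij by (intro bij_comp bij_translation bij_imp_bij_inv)
      moreover have "(conj q u, conj q v) \<in> parcs R \<longleftrightarrow> (u, v) \<in> parcs R" for u v
        unfolding adj[symmetric] \<phi>_conj by (rule translation_aut_Gamma_h)
      ultimately show ?thesis unfolding assms(4) by (simp add: graph_automorphisms_Gamma_iff)
    qed
    moreover have "inj conj"
    proof (rule injI)
      fix q q' assume "conj q = conj q'"
      then have "translation (fst q) (snd q) (\<phi> v) = translation (fst q') (snd q') (\<phi> v)" for v
        by (metis \<phi>_conj)
      then have "translation (fst q) (snd q) w = translation (fst q') (snd q') w" for w
        using bij by (metis bij_pointE)
      then have "translation (fst q) (snd q) = translation (fst q') (snd q')" by blast
      then show "q = q'" by (simp add: translation_eq_iff prod_eq_iff)
    qed
    ultimately have "CARD('a \<times> 'a) \<le> card (graph_automorphisms R)"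
      by (intro card_inj_on_le[of conj]) auto
    then have "p * p \<le> p" using card assms(3) by simp
    then show False using \<open>2 \<le> p\<close> by simp
  qed
  ultimately show ?thesis by blast
qed

end
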